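(* For every integer $k\ge 1$: (i) every quasi-bipartite graph with $k$ terminals admits an exact (quality-$1$) contraction-based cut sparsifier with $2^{O(k^2\log k)}$ vertices; and (ii) there exists a quasi-bipartite graph with $k$ terminals every exact contraction-based cut sparsifier of which contains $\Omega(2^k)$ vertices.
   Context: Graphs are undirected with positive edge weights (capacities); $T\subseteq V(G)$ is the terminal set, $|T|=k$. A graph is quasi-bipartite (with respect to $T$) if every edge is incident to some terminal, i.e., there is no edge between two non-terminals. For a partition $(T_1,T_2)$ of $T$ into non-empty subsets, $\mathrm{mincut}_G(T_1,T_2)$ is the minimum total weight of an edge set whose removal disconnects $T_1$ from $T_2$. A graph $H$ is a contraction-based sparsifier of $G$ with respect to $T$ if there is a partition $\mathcal L$ of $V(G)$ in which distinct terminals lie in distinct parts, and $H$ is obtained from $G$ by contracting each part $L\in\mathcal L$ into a single vertex, keeping parallel edges and discarding self-loops. It is an exact cut sparsifier if $\mathrm{mincut}_H(T_1,T_2)=\mathrm{mincut}_G(T_1,T_2)$ for every partition $(T_1,T_2)$ of $T$ into non-empty subsets. *)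

theory Defs
  imports Complex_Main "HOL-Library.Disjoint_Sets"
begin

text \<open>
  Edges carry their own identity, so that parallel edges survive contraction.
  The endpoints of an edge form an unordered pair, represented as a two-element set.
\<close>

record ('v, 'e) wgraph =
  verts :: "'v set"
  edges :: "'e set"
  ends :: "'e \<Rightarrow> 'v set"
  weight :: "'e \<Rightarrow> real"

definition wf_graph :: "('v, 'e) wgraph \<Rightarrow> bool" where
  "wf_graph G \<longleftrightarrow> finite (verts G) \<and> finite (edges G) \<and>
     (\<forall>e\<in>edges G. ends G e \<subseteq> verts G \<and> card (ends G e) = 2 \<and> weight G e > 0)"

definition simple_graph :: "('v, 'e) wgraph \<Rightarrow> bool" where
  "simple_graph G \<longleftrightarrow> inj_on (ends G) (edges G)"

definition quasi_bipartite :: "('v, 'e) wgraph \<Rightarrow> 'v set \<Rightarrow> bool" where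
  "quasi_bipartite G T \<longleftrightarrow> (\<forall>e\<in>edges G. ends G e \<inter> T \<noteq> {})"

definition adj_without :: "('v, 'e) wgraph \<Rightarrow> 'e set \<Rightarrow> ('v \<times> 'v) set" where
  "adj_without G F = {(u, v). \<exists>e\<in>edges G - F. ends G e = {u, v}}"

definition disconnects :: "('v, 'e) wgraph \<Rightarrow> 'e set \<Rightarrow> 'v set \<Rightarrow> 'v set \<Rightarrow> bool" where
  "disconnects G F A B \<longleftrightarrow> (\<forall>a\<in>A. \<forall>b\<in>B. (a, b) \<notin> (adj_without G F)\<^sup>*)"

text \<open>
  For finite \<^term>\<open>G\<close> and disjoint \<^term>\<open>A\<close>, \<^term>\<open>B\<close> the minimum is over a finite set
  that is non-empty, since removing all edges disconnects \<^term>\<open>A\<close> from \<^term>\<open>B\<close>.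
\<close>

definition mincut :: "('v, 'e) wgraph \<Rightarrow> 'v set \<Rightarrow> 'v set \<Rightarrow> real" where
  "mincut G A B = Min {sum (weight G) F | F. F \<subseteq> edges G \<and> disconnects G F A B}"

text \<open>
  The vertices of the contracted graph are the parts of \<^term>\<open>L\<close> themselves; an edge with both
  endpoints in one part would become a self-loop and is dropped.
\<close>

definition contract :: "('v, 'e) wgraph \<Rightarrow> 'v set set \<Rightarrow> ('v set, 'e) wgraph" where
  "contract G L = \<lparr>
     verts = L,
     edges = {e \<in> edges G. \<not> (\<exists>P\<in>L. ends G e \<subseteq> P)},
     ends = (\<lambda>e. {P \<in> L. P \<inter> ends G e \<noteq> {}}),
     weight = weight G\<rparr>"

definition contraction_based_sparsifier ::
    "('v, 'e) wgraph \<Rightarrow> 'v set \<Rightarrow> ('v set, 'e) wgraph \<Rightarrow> bool" where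
  "contraction_based_sparsifier G T H \<longleftrightarrow>
     (\<exists>L. partition_on (verts G) L \<and>
          (\<forall>P\<in>L. \<forall>s\<in>P \<inter> T. \<forall>t\<in>P \<inter> T. s = t) \<and>
          H = contract G L)"

text \<open>A terminal of \<open>G\<close> is identified with the vertex of \<open>H\<close> (a part) that contains it.\<close>

definition lift_verts :: "('v set, 'e) wgraph \<Rightarrow> 'v set \<Rightarrow> 'v set set" where
  "lift_verts H S = {P \<in> verts H. P \<inter> S \<noteq> {}}"

definition exact_cut_sparsifier ::
    "('v, 'e) wgraph \<Rightarrow> 'v set \<Rightarrow> ('v set, 'e) wgraph \<Rightarrow> bool" where
  "exact_cut_sparsifier G T H \<longleftrightarrow>
     (\<forall>T1 T2. T1 \<union> T2 = T \<and> T1 \<inter> T2 = {} \<and> T1 \<noteq> {} \<and> T2 \<noteq> {} \<longrightarrow>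
        mincut H (lift_verts H T1) (lift_verts H T2) = mincut G T1 T2)"

end

theory Submission
  imports Defs "HOL-Library.Nat_Bijection" "HOL-Library.FuncSet"
begin

text \<open>
  In a quasi-bipartite graph the minimum cut separating \<open>T1\<close> from \<open>T2\<close> decides independently for each
  non-terminal \<open>v\<close>, which joins the side to which it has the heavier link. So \<open>v\<close> matters only
  through its family of heavy sides \<open>{S \<subseteq> T. link v S > link v (T - S)}\<close>, and contracting
  non-terminals with equal families is exact. Such a family consists of the points of the cube
  with \<open>2 * link v S - link v T > 0\<close>, a linear threshold function, and (Chow) a threshold function
  is determined by its number of true points together with their coordinate sums: the family
  maximises the total of \<open>2 * link v S - link v T\<close>, and this total depends only on these \<open>k + 1\<close>
  numbers. Each of them is at most \<open>2 ^ k\<close>.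

  For the lower bound, take one non-terminal for each odd-sized set of terminals, joined to it by
  unit edges. Two different odd sets have strictly opposite majorities for some bipartition of the
  terminals, so no two non-terminals may be identified.
\<close>

section \<open>Minimum cuts as vertex cuts\<close>

definition crossing :: "('v, 'e) wgraph \<Rightarrow> 'v set \<Rightarrow> 'e set" where
  "crossing G U = {e \<in> edges G. ends G e \<inter> U \<noteq> {} \<and> ends G e - U \<noteq> {}}"

definition cut_weight :: "('v, 'e) wgraph \<Rightarrow> 'v set \<Rightarrow> real" where
  "cut_weight G U = sum (weight G) (crossing G U)"

lemma finite_disconnecting_weights:
  assumes "wf_graph G"
  shows "finite {sum (weight G) F | F. F \<subseteq> edges G \<and> disconnects G F A B}"
proof -
  have "finite (Pow (edges G))"
    using assms by (simp add: wf_graph_def)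
  moreover have "{sum (weight G) F | F. F \<subseteq> edges G \<and> disconnects G F A B}
      \<subseteq> sum (weight G) ` Pow (edges G)"
    by auto
  ultimately show ?thesis
    by (meson finite_imageI finite_subset)
qed

text \<open>Once the crossing edges are gone, no walk starting in \<open>U\<close> leaves it, so the
  crossing set competes in the minimum.\<close>

lemma mincut_le_cut_weight:
  assumes "wf_graph G" "A \<subseteq> U" "B \<inter> U = {}"
  shows "mincut G A B \<le> cut_weight G U"
proof -
  have stay: "y \<in> U" if "(x, y) \<in> (adj_without G (crossing G U))\<^sup>*" "x \<in> U" for x y
    using that
  proof (induction rule: rtrancl_induct)
    case (step y z)
    then obtain e where "e \<in> edges G - crossing G U" "ends G e = {y, z}"
      by (auto simp: adj_without_def)
    with step show ?case
      by (auto simp: crossing_def)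
  qed
  have "disconnects G (crossing G U) A B"
    unfolding disconnects_def using stay assms by blast
  moreover have "crossing G U \<subseteq> edges G"
    by (auto simp: crossing_def)
  ultimately show ?thesis
    unfolding mincut_def cut_weight_def
    by (intro Min_le finite_disconnecting_weights assms) auto
qed

text \<open>\<open>U\<close> is what remains reachable from \<open>A\<close> after removing an
  optimal \<open>F\<close>; an edge leaving \<open>U\<close> outside \<open>F\<close> would extend
  reachability. With the previous lemma, \<open>mincut\<close> becomes a minimum over vertex
  sets.\<close>

lemma ex_cut_weight_le_mincut:
  assumes wf: "wf_graph G" and "A \<inter> B = {}"
  shows "\<exists>U. A \<subseteq> U \<and> B \<inter> U = {} \<and> cut_weight G U \<le> mincut G A B"
proof -
  let ?M = "{sum (weight G) F | F. F \<subseteq> edges G \<and> disconnects G F A B}"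
  \<comment> \<open>Removing every edge leaves only trivial walks, so disjointness of
    \<open>A\<close> and \<open>B\<close> makes the minimum range over a non-empty set.\<close>
  have "adj_without G (edges G) = {}"
    by (auto simp: adj_without_def)
  then have "disconnects G (edges G) A B"
    using assms by (auto simp: disconnects_def)
  then have "?M \<noteq> {}"
    by blast
  then have "mincut G A B \<in> ?M"
    unfolding mincut_def by (intro Min_in finite_disconnecting_weights wf)
  then obtain F where F: "F \<subseteq> edges G" "disconnects G F A B" "mincut G A B = sum (weight G) F"
    by blast
  define U where "U = {v. \<exists>a\<in>A. (a, v) \<in> (adj_without G F)\<^sup>*}"
  have "crossing G U \<subseteq> F"
  proof
    fix e assume e: "e \<in> crossing G U"
    then obtain x y where xy: "x \<in> ends G e" "x \<in> U" "y \<in> ends G e" "y \<notin> U"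
      by (auto simp: crossing_def)
    have "card (ends G e) = 2"
      using e wf by (auto simp: crossing_def wf_graph_def)
    then have "ends G e = {x, y}"
      using xy by (metis card_2_iff doubleton_eq_iff insertE singletonD)
    show "e \<in> F"
    proof (rule ccontr)
      assume "e \<notin> F"
      then have "(x, y) \<in> adj_without G F"
        using e \<open>ends G e = {x, y}\<close> by (auto simp: crossing_def adj_without_def)
      with xy show False
        unfolding U_def by (auto intro: rtrancl_into_rtrancl)
    qed
  qed
  then have "cut_weight G U \<le> mincut G A B"
    unfolding cut_weight_def F(3) using F(1) wf
    by (intro sum_mono2) (auto simp: wf_graph_def intro: finite_subset less_imp_le)
  moreover have "A \<subseteq> U" "B \<inter> U = {}"
    using F(2) by (auto simp: U_def disconnects_def)
  ultimately show ?thesis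
    by blast
qed

section \<open>Contractions\<close>

lemma partition_on_part_unique:
  "\<lbrakk>partition_on V L; P \<in> L; Q \<in> L; x \<in> P; x \<in> Q\<rbrakk> \<Longrightarrow> P = Q"
  by (auto simp: partition_on_def disjoint_def)

lemma wf_graph_contract:
  assumes wf: "wf_graph G" and L: "partition_on (verts G) L"
  shows "wf_graph (contract G L)"
proof -
  have "card {P \<in> L. P \<inter> ends G e \<noteq> {}} = 2"
    if e: "e \<in> edges G" "\<not> (\<exists>P\<in>L. ends G e \<subseteq> P)" for e
  proof -
    have "card (ends G e) = 2" "ends G e \<subseteq> verts G"
      using wf e by (auto simp: wf_graph_def)
    then obtain x y where xy: "ends G e = {x, y}" "x \<in> verts G" "y \<in> verts G"
      by (auto simp: card_2_iff)
    then obtain P Q where PQ: "P \<in> L" "x \<in> P" "Q \<in> L" "y \<in> Q"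
      using partition_onD1[OF L] by auto
    then have "P \<noteq> Q"
      using e xy by auto
    moreover have "{P \<in> L. P \<inter> ends G e \<noteq> {}} = {P, Q}"
      using partition_on_part_unique[OF L] PQ xy by auto
    ultimately show ?thesis
      by simp
  qed
  moreover have "finite L"
    using finite_elements[OF _ L] wf by (auto simp: wf_graph_def)
  ultimately show ?thesis
    using wf by (auto simp: wf_graph_def contract_def)
qed

text \<open>Edges keep their identity, so both sides are the very same set: a dropped edge lies
  within one part, and a part is either contained in \<open>\<Union>W\<close> or disjoint from
  it.\<close>

lemma crossing_contract:
  assumes wf: "wf_graph G" and L: "partition_on (verts G) L" and W: "W \<subseteq> L"
  shows "crossing (contract G L) W = crossing G (\<Union>W)"
proof (intro set_eqI iffI)
  fix e assume "e \<in> crossing (contract G L) W"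
  then obtain P Q where PQ: "e \<in> edges G" "P \<in> W" "P \<inter> ends G e \<noteq> {}"
      "Q \<in> L" "Q \<notin> W" "Q \<inter> ends G e \<noteq> {}"
    by (auto simp: crossing_def contract_def)
  then obtain y where y: "y \<in> Q" "y \<in> ends G e"
    by auto
  have "y \<notin> \<Union>W"
    using partition_on_part_unique[OF L] y PQ W by blast
  then show "e \<in> crossing G (\<Union>W)"
    using PQ y by (auto simp: crossing_def)
next
  fix e assume "e \<in> crossing G (\<Union>W)"
  then obtain x y P where e: "e \<in> edges G" "x \<in> ends G e" "x \<in> P" "P \<in> W"
      "y \<in> ends G e" "y \<notin> \<Union>W"
    by (auto simp: crossing_def)
  then have "y \<in> verts G"
    using wf by (auto simp: wf_graph_def)
  then obtain Q where Q: "Q \<in> L" "y \<in> Q"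
    using partition_onD1[OF L] by auto
  have "\<not> (\<exists>R\<in>L. ends G e \<subseteq> R)"
    using partition_on_part_unique[OF L] e W by blast
  then show "e \<in> crossing (contract G L) W"
    using e Q W by (auto simp: crossing_def contract_def)
qed

lemma cut_weight_contract:
  assumes "wf_graph G" "partition_on (verts G) L" "W \<subseteq> L"
  shows "cut_weight (contract G L) W = cut_weight G (\<Union>W)"
  using crossing_contract[OF assms] by (simp add: cut_weight_def contract_def)

lemma mincut_contract_le:
  assumes "wf_graph G" and L: "partition_on (verts G) L"
    and W: "W \<subseteq> L" "T1 \<subseteq> \<Union>W" "T2 \<inter> \<Union>W = {}"
  shows "mincut (contract G L) (lift_verts (contract G L) T1) (lift_verts (contract G L) T2)
    \<le> cut_weight G (\<Union>W)"
proof -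
  have "lift_verts (contract G L) T1 \<subseteq> W"
    using partition_on_part_unique[OF L] W
    unfolding lift_verts_def contract_def by fastforce
  moreover have "lift_verts (contract G L) T2 \<inter> W = {}"
    using W by (auto simp: lift_verts_def)
  ultimately show ?thesis
    using mincut_le_cut_weight[OF wf_graph_contract[OF assms(1) L]]
    by (metis cut_weight_contract[OF assms(1) L W(1)])
qed

text \<open>Cuts of the contraction are the cuts of \<open>G\<close> along unions of parts.
  Separation of the terminals makes the lifted sides disjoint, which guarantees an optimal
  cut.\<close>

lemma ex_cut_weight_le_mincut_contract:
  assumes wf: "wf_graph G" and L: "partition_on (verts G) L"
    and T: "T1 \<union> T2 \<subseteq> verts G" "T1 \<inter> T2 = {}"
    and sep: "\<And>P s t. \<lbrakk>P \<in> L; s \<in> P \<inter> (T1 \<union> T2); t \<in> P \<inter> (T1 \<union> T2)\<rbrakk> \<Longrightarrow> s = t"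
  shows "\<exists>W\<subseteq>L. T1 \<subseteq> \<Union>W \<and> T2 \<inter> \<Union>W = {} \<and> cut_weight G (\<Union>W) \<le>
    mincut (contract G L) (lift_verts (contract G L) T1) (lift_verts (contract G L) T2)"
proof -
  let ?H = "contract G L"
  have disj: "lift_verts ?H T1 \<inter> lift_verts ?H T2 = {}"
    using sep T(2) by (fastforce simp: lift_verts_def contract_def)
  obtain U where U: "lift_verts ?H T1 \<subseteq> U" "lift_verts ?H T2 \<inter> U = {}"
      "cut_weight ?H U \<le> mincut ?H (lift_verts ?H T1) (lift_verts ?H T2)"
    using ex_cut_weight_le_mincut[OF wf_graph_contract[OF wf L] disj] by blast
  \<comment> \<open>\<open>U\<close> may contain sets that are not parts; no edge ends in
    them.\<close>
  have "crossing ?H U = crossing ?H (U \<inter> L)"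
    by (auto simp: crossing_def contract_def)
  then have "cut_weight ?H U = cut_weight G (\<Union>(U \<inter> L))"
    using cut_weight_contract[OF wf L, of "U \<inter> L"] by (simp add: cut_weight_def)
  moreover have "T1 \<subseteq> \<Union>(U \<inter> L)"
  proof
    fix t assume "t \<in> T1"
    then obtain P where "P \<in> L" "t \<in> P"
      using T partition_onD1[OF L] by auto
    then show "t \<in> \<Union>(U \<inter> L)"
      using U(1) \<open>t \<in> T1\<close> by (auto simp: lift_verts_def contract_def)
  qed
  moreover have "T2 \<inter> \<Union>(U \<inter> L) = {}"
    using U(2) by (auto simp: lift_verts_def contract_def)
  ultimately show ?thesis
    using U(3) by (intro exI[of _ "U \<inter> L"]) auto
qed

section \<open>Cuts in quasi-bipartite graphs\<close>

definition link :: "('v, 'e) wgraph \<Rightarrow> 'v \<Rightarrow> 'v set \<Rightarrow> real" where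
  "link G v S = sum (weight G) {e \<in> edges G. v \<in> ends G e \<and> ends G e \<inter> S \<noteq> {}}"

text \<open>An edge not inside \<open>T\<close> has exactly one non-terminal end, so the crossing
  edges split by that end. The first summand depends on \<open>T1\<close> only, which leaves an
  independent choice for each non-terminal.\<close>

lemma cut_weight_quasi_bipartite:
  assumes wf: "wf_graph G" and qb: "quasi_bipartite G T"
    and T: "T1 \<union> T2 = T" "T1 \<subseteq> U" "T2 \<inter> U = {}"
  shows "cut_weight G U = sum (weight G) {e \<in> crossing G T1. ends G e \<subseteq> T}
    + (\<Sum>v\<in>verts G - T. if v \<in> U then link G v T2 else link G v T1)"
proof -
  have fin: "finite (edges G)" "finite (verts G)"
    using wf by (auto simp: wf_graph_def)
  have ends2: "\<exists>x y. ends G e = {x, y} \<and> x \<noteq> y" if "e \<in> edges G" for e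
    using wf that by (auto simp: wf_graph_def card_2_iff)
  define X where "X v = {e \<in> crossing G U. v \<in> ends G e}" for v
  have meets: "ends G e \<inter> T \<noteq> {}" if "e \<in> edges G" for e
    using qb that by (auto simp: quasi_bipartite_def)
  have split: "crossing G U = {e \<in> crossing G T1. ends G e \<subseteq> T} \<union> (\<Union>v\<in>verts G - T. X v)"
    (is "_ = ?R")
  proof (intro set_eqI iffI)
    fix e assume e: "e \<in> crossing G U"
    show "e \<in> ?R"
    proof (cases "ends G e \<subseteq> T")
      case True
      then show ?thesis
        using e T by (auto simp: crossing_def)
    next
      case False
      then show ?thesis
        using e wf by (auto simp: crossing_def X_def wf_graph_def)
    qed
  next
    fix e assume "e \<in> ?R"
    then show "e \<in> crossing G U"
      using T by (auto simp: crossing_def X_def)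
  qed
  have X_link: "sum (weight G) (X v) = (if v \<in> U then link G v T2 else link G v T1)"
    if v: "v \<in> verts G - T" for v
  proof -
    \<comment> \<open>The other end of an edge at \<open>v\<close> is a terminal, and the edge
      crosses exactly when that terminal lies on the opposite side.\<close>
    have "X v = {e \<in> edges G. v \<in> ends G e \<and> ends G e \<inter> (if v \<in> U then T2 else T1) \<noteq> {}}"
    proof (intro set_eqI iffI)
      fix e assume e: "e \<in> X v"
      then have "e \<in> edges G" "v \<in> ends G e"
        by (auto simp: X_def crossing_def)
      then obtain y where y: "ends G e = {v, y}"
        using ends2 by fastforce
      then have "y \<in> T"
        using meets[OF \<open>e \<in> edges G\<close>] v by auto
      then show "e \<in> {e \<in> edges G. v \<in> ends G e \<and> ends G e \<inter> (if v \<in> U then T2 else T1) \<noteq> {}}"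
        using e y T by (auto simp: X_def crossing_def)
    next
      fix e assume "e \<in> {e \<in> edges G. v \<in> ends G e \<and> ends G e \<inter> (if v \<in> U then T2 else T1) \<noteq> {}}"
      then show "e \<in> X v"
        using T by (auto simp: X_def crossing_def split: if_splits)
    qed
    then show ?thesis
      by (simp add: link_def)
  qed
  have finX: "finite (X v)" for v
    using fin by (auto simp: X_def crossing_def)
  \<comment> \<open>An edge counted twice would join two non-terminals.\<close>
  have "X v \<inter> X w = {}" if "v \<in> verts G - T" "w \<in> verts G - T" "v \<noteq> w" for v w
  proof (rule ccontr)
    assume "X v \<inter> X w \<noteq> {}"
    then obtain e where e: "e \<in> edges G" "v \<in> ends G e" "w \<in> ends G e"
      by (auto simp: X_def crossing_def)
    then have "ends G e = {v, w}"
      using ends2[of e] that by auto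
    then show False
      using meets[OF e(1)] that by auto
  qed
  then have "sum (weight G) (\<Union>v\<in>verts G - T. X v) = (\<Sum>v\<in>verts G - T. sum (weight G) (X v))"
    using fin finX by (intro sum.UNION_disjoint) auto
  also have "\<dots> = (\<Sum>v\<in>verts G - T. if v \<in> U then link G v T2 else link G v T1)"
    using X_link by (intro sum.cong) auto
  finally have nt: "sum (weight G) (\<Union>v\<in>verts G - T. X v) = \<dots>" .
  have "cut_weight G U = sum (weight G) {e \<in> crossing G T1. ends G e \<subseteq> T}
      + sum (weight G) (\<Union>v\<in>verts G - T. X v)"
    unfolding cut_weight_def split using fin finX
    by (intro sum.union_disjoint) (auto simp: crossing_def X_def)
  then show ?thesis
    using nt by simp
qed

text \<open>Ties go to the side of \<open>T - T1\<close>, as in \<open>heavy_sets\<close>; so for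
  \<open>T1 \<subseteq> T\<close> a non-terminal \<open>v\<close> lies here exactly when
  \<open>T1\<close> belongs to \<open>heavy_sets G T v\<close>.\<close>

definition heavier_side :: "('v, 'e) wgraph \<Rightarrow> 'v set \<Rightarrow> 'v set \<Rightarrow> 'v set" where
  "heavier_side G T T1 = T1 \<union> {v \<in> verts G - T. link G v T1 > link G v (T - T1)}"

text \<open>Every non-terminal pays the smaller of its two links, so the comparison holds term by
  term.\<close>

lemma cut_weight_heavier_side_le:
  assumes wf: "wf_graph G" and qb: "quasi_bipartite G T"
    and T: "T1 \<union> T2 = T" "T1 \<inter> T2 = {}" "T1 \<subseteq> U" "T2 \<inter> U = {}"
  shows "cut_weight G (heavier_side G T T1) \<le> cut_weight G U"
proof -
  have T2: "T2 = T - T1"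
    using T by auto
  have "T2 \<inter> heavier_side G T T1 = {}"
    using T by (auto simp: heavier_side_def)
  then show ?thesis
    using cut_weight_quasi_bipartite[OF wf qb T(1,3,4)]
      cut_weight_quasi_bipartite[OF wf qb T(1), of "heavier_side G T T1"] T(1)
    by (auto simp: heavier_side_def T2 intro!: sum_mono)
qed

text \<open>\<open>U\<close> keeps \<open>u\<close> and \<open>v\<close> together although they
  strictly prefer different sides, so one of the two pays its heavier link.\<close>

lemma cut_weight_heavier_side_less:
  assumes wf: "wf_graph G" and qb: "quasi_bipartite G T"
    and T: "T1 \<union> T2 = T" "T1 \<inter> T2 = {}" "T1 \<subseteq> U" "T2 \<inter> U = {}"
    and uv: "u \<in> verts G - T" "v \<in> verts G - T" "u \<in> U \<longleftrightarrow> v \<in> U"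
    and opp: "link G u T1 > link G u T2" "link G v T1 < link G v T2"
  shows "cut_weight G (heavier_side G T T1) < cut_weight G U"
proof -
  have T2: "T2 = T - T1"
    using T by auto
  have fin: "finite (verts G - T)"
    using wf by (simp add: wf_graph_def)
  have "T2 \<inter> heavier_side G T T1 = {}"
    using T by (auto simp: heavier_side_def)
  moreover have
    "(\<Sum>v\<in>verts G - T. if v \<in> heavier_side G T T1 then link G v T2 else link G v T1)
      < (\<Sum>v\<in>verts G - T. if v \<in> U then link G v T2 else link G v T1)"
  proof (rule sum_strict_mono_ex1[OF fin])
    show "\<forall>x\<in>verts G - T. (if x \<in> heavier_side G T T1 then link G x T2 else link G x T1)
        \<le> (if x \<in> U then link G x T2 else link G x T1)"
      using T(1) by (auto simp: heavier_side_def T2)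
    have "u \<in> heavier_side G T T1" "v \<notin> heavier_side G T T1"
      using uv opp T by (auto simp: heavier_side_def T2)
    then show "\<exists>x\<in>verts G - T. (if x \<in> heavier_side G T T1 then link G x T2 else link G x T1)
        < (if x \<in> U then link G x T2 else link G x T1)"
      \<comment> \<open>If \<open>u\<close> is in \<open>U\<close>, then \<open>v\<close> is the
        misplaced one; otherwise \<open>u\<close> is.\<close>
      using uv opp by (cases "u \<in> U") (auto intro: bexI[of _ u] bexI[of _ v])
  qed
  ultimately show ?thesis
    using cut_weight_quasi_bipartite[OF wf qb T(1,3,4)]
      cut_weight_quasi_bipartite[OF wf qb T(1), of "heavier_side G T T1"]
    by (auto simp: heavier_side_def)
qed

section \<open>The sparsifier\<close>

definition heavy_sets :: "('v, 'e) wgraph \<Rightarrow> 'v set \<Rightarrow> 'v \<Rightarrow> 'v set set" where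
  "heavy_sets G T v = {S \<in> Pow T. link G v S > link G v (T - S)}"

text \<open>An edge at \<open>v\<close> has only one other end, so it meets \<open>S\<close> in at
  most one terminal and is counted once.\<close>

lemma link_eq_sum:
  assumes wf: "wf_graph G" and "finite T" "S \<subseteq> T" "v \<notin> T"
  shows "link G v S = (\<Sum>t\<in>S. link G v {t})"
proof -
  have "finite S"
    using assms finite_subset by blast
  have "e \<notin> edges G"
    if "v \<in> ends G e" "s \<in> ends G e" "t \<in> ends G e" "s \<in> S" "t \<in> S" "s \<noteq> t" for e s t
  proof
    assume "e \<in> edges G"
    then have "card (ends G e) = 2"
      using wf by (auto simp: wf_graph_def)
    then show False
      using that assms by (auto simp: card_2_iff)
  qed
  moreover have "{e \<in> edges G. v \<in> ends G e \<and> ends G e \<inter> S \<noteq> {}}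
      = (\<Union>t\<in>S. {e \<in> edges G. v \<in> ends G e \<and> ends G e \<inter> {t} \<noteq> {}})"
    by auto
  ultimately show ?thesis
    unfolding link_def using wf \<open>finite S\<close>
    by (simp only:) (intro sum.UNION_disjoint; auto simp: wf_graph_def)
qed

section \<open>Chow parameters of threshold families\<close>

text \<open>Up to normalisation, these are the Chow parameters of the indicator function of
  \<open>A\<close>. Restricting the counts to \<open>T\<close> places them in an extensional
  function space, whose size is known.\<close>

definition chow_parameters :: "'a set \<Rightarrow> 'a set set \<Rightarrow> nat \<times> ('a \<Rightarrow> nat)" where
  "chow_parameters T A = (card A, \<lambda>t\<in>T. card {S \<in> A. t \<in> S})"

text \<open>Exchanging the sums counts \<open>w t\<close> once per member of \<open>A\<close>
  containing \<open>t\<close>; hence the total is linear in the Chow parameters.\<close>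

lemma sum_sum_eq_chow:
  fixes w :: "'a \<Rightarrow> real"
  assumes "finite T" "A \<subseteq> Pow T"
  shows "(\<Sum>S\<in>A. sum w S - c) =
    (\<Sum>t\<in>T. w t * real (snd (chow_parameters T A) t)) - c * real (fst (chow_parameters T A))"
proof -
  have finA: "finite A"
    using assms finite_subset by blast
  have "(\<Sum>S\<in>A. sum w S) = (\<Sum>S\<in>A. \<Sum>t\<in>T. if t \<in> S then w t else 0)"
  proof (rule sum.cong[OF refl])
    fix S assume "S \<in> A"
    then have "T \<inter> {t. t \<in> S} = S"
      using assms by auto
    then show "sum w S = (\<Sum>t\<in>T. if t \<in> S then w t else 0)"
      using assms by (simp add: sum.If_cases)
  qed
  also have "\<dots> = (\<Sum>t\<in>T. \<Sum>S\<in>A. if t \<in> S then w t else 0)"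
    by (rule sum.swap)
  also have "\<dots> = (\<Sum>t\<in>T. w t * real (card {S \<in> A. t \<in> S}))"
    using finA by (intro sum.cong refl) (simp add: sum.If_cases Int_def)
  also have "\<dots> = (\<Sum>t\<in>T. w t * real (snd (chow_parameters T A) t))"
    by (intro sum.cong) (auto simp: chow_parameters_def)
  finally show ?thesis
    by (simp add: sum_subtractf chow_parameters_def)
qed

text \<open>\<open>B\<close> collects exactly the sets of positive value, and equal parameters force
  equal totals over \<open>A\<close> and \<open>B\<close>. After cancelling the common part,
  \<open>A - B\<close> contributes at most zero, while a non-empty \<open>B - A\<close> would
  contribute a positive amount.\<close>

lemma threshold_family_subset:
  fixes w :: "'a \<Rightarrow> real"
  assumes "finite T" "A \<subseteq> Pow T" "B = {S \<in> Pow T. sum w S - c > 0}"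
    and eq: "chow_parameters T A = chow_parameters T B"
  shows "B \<subseteq> A"
proof (rule ccontr)
  assume "\<not> B \<subseteq> A"
  then have ne: "B - A \<noteq> {}"
    by blast
  have subB: "B \<subseteq> Pow T"
    using assms(3) by auto
  have fin: "finite A" "finite B"
    using assms(1,2) subB finite_subset[of _ "Pow T"] by auto
  let ?f = "\<lambda>S. sum w S - c"
  have "sum ?f A = sum ?f B"
    using sum_sum_eq_chow[OF \<open>finite T\<close>, of A w c] sum_sum_eq_chow[OF \<open>finite T\<close>, of B w c]
      assms(2) subB eq by simp
  moreover have "sum ?f A = sum ?f (A - B) + sum ?f (A \<inter> B)"
    using fin by (subst sum.union_disjoint[symmetric]) (auto intro!: arg_cong2[where f = sum])
  moreover have "sum ?f B = sum ?f (B - A) + sum ?f (A \<inter> B)"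
    using fin by (subst sum.union_disjoint[symmetric]) (auto intro!: arg_cong2[where f = sum])
  moreover have "sum ?f (A - B) \<le> 0"
    using assms by (intro sum_nonpos) fastforce
  moreover have "sum ?f (B - A) > 0"
    using fin ne assms by (intro sum_pos) auto
  ultimately show False
    by linarith
qed

text \<open>The links to \<open>S\<close> and \<open>T - S\<close> add up to
  \<open>link G v T\<close>, so being heavier means exceeding half of it.\<close>

lemma heavy_sets_eq_threshold:
  assumes wf: "wf_graph G" and T: "finite T" "v \<notin> T"
  shows "heavy_sets G T v = {S \<in> Pow T. (\<Sum>t\<in>S. link G v {t}) - link G v T / 2 > 0}"
proof -
  have link: "link G v S = (\<Sum>t\<in>S. link G v {t})" if "S \<subseteq> T" for S
    by (rule link_eq_sum[OF wf T(1) that T(2)])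
  have "link G v S > link G v (T - S) \<longleftrightarrow> (\<Sum>t\<in>S. link G v {t}) - link G v T / 2 > 0"
    if S: "S \<subseteq> T" for S
  proof -
    have "link G v (T - S) = link G v T - link G v S"
      unfolding link[OF S] link[OF Diff_subset] link[OF order.refl] by (rule sum_diff[OF T(1) S])
    then show ?thesis
      unfolding link[OF S, symmetric] by linarith
  qed
  then show ?thesis
    unfolding heavy_sets_def by blast
qed

text \<open>Both families are threshold families, each with its own weights, so the inclusion
  applies in both directions.\<close>

lemma inj_on_chow_heavy_sets:
  assumes "wf_graph G" "finite T"
  shows "inj_on (chow_parameters T) (heavy_sets G T ` (verts G - T))"
proof (rule inj_onI)
  fix A B assume "A \<in> heavy_sets G T ` (verts G - T)" "B \<in> heavy_sets G T ` (verts G - T)"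
    and eq: "chow_parameters T A = chow_parameters T B"
  then obtain u v where u: "u \<notin> T" "A = heavy_sets G T u" and v: "v \<notin> T" "B = heavy_sets G T v"
    by auto
  have sub: "A \<subseteq> Pow T" "B \<subseteq> Pow T"
    unfolding u v heavy_sets_def by auto
  show "A = B"
  proof
    show "B \<subseteq> A"
      using threshold_family_subset[OF assms(2) sub(1) _ eq] heavy_sets_eq_threshold[OF assms v(1)] v
      by blast
    show "A \<subseteq> B"
      using threshold_family_subset[OF assms(2) sub(2) _ eq[symmetric]]
        heavy_sets_eq_threshold[OF assms u(1)] u
      by blast
  qed
qed

text \<open>Each of the \<open>card T + 1\<close> Chow parameters counts some family of subsets of
  \<open>T\<close>, which leaves \<open>2 ^ card T + 1\<close> possible values.\<close>

lemma card_heavy_sets_le: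
  assumes "wf_graph G" "finite T"
  shows "card (heavy_sets G T ` (verts G - T)) \<le> (2 ^ card T + 1) ^ (card T + 1)"
proof -
  let ?N = "{..(2::nat) ^ card T}"
  have bound: "card B \<le> 2 ^ card T" if "B \<subseteq> Pow T" for B
    using card_mono[OF _ that] assms(2) by (simp add: card_Pow)
  have "chow_parameters T ` heavy_sets G T ` (verts G - T) \<subseteq> ?N \<times> (T \<rightarrow>\<^sub>E ?N)"
    unfolding chow_parameters_def heavy_sets_def by (auto intro!: bound)
  moreover have fin: "finite (?N \<times> (T \<rightarrow>\<^sub>E ?N))"
    using assms(2) by (simp add: finite_PiE)
  ultimately have "card (heavy_sets G T ` (verts G - T)) \<le> card (?N \<times> (T \<rightarrow>\<^sub>E ?N))"
    using card_inj_on_le[OF inj_on_chow_heavy_sets[OF assms]] by blast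
  also have "\<dots> = (2 ^ card T + 1) ^ (card T + 1)"
    using assms(2) by (simp add: card_cartesian_product card_PiE)
  finally show ?thesis .
qed

section \<open>The contraction by heavy families\<close>

text \<open>Classes are indexed by attained families only, so that no part is empty.\<close>

definition heavy_partition :: "('v, 'e) wgraph \<Rightarrow> 'v set \<Rightarrow> 'v set set" where
  "heavy_partition G T = (\<lambda>t. {t}) ` T \<union>
     (\<lambda>A. {v \<in> verts G - T. heavy_sets G T v = A}) ` heavy_sets G T ` (verts G - T)"

lemma partition_on_heavy_partition:
  assumes "T \<subseteq> verts G"
  shows "partition_on (verts G) (heavy_partition G T)"
  using assms by (intro partition_onI) (auto simp: heavy_partition_def disjnt_def)

text \<open>Non-terminals of one class always choose the same side, so the optimal set
  \<open>heavier_side G T T1\<close> is a union of parts and survives the contraction; conversely,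
  every cut of the contraction is a cut of \<open>G\<close>.\<close>

lemma exact_cut_sparsifier_heavy_partition:
  assumes wf: "wf_graph G" and T: "T \<subseteq> verts G" and qb: "quasi_bipartite G T"
  shows "exact_cut_sparsifier G T (contract G (heavy_partition G T))"
  unfolding exact_cut_sparsifier_def
proof (intro allI impI)
  fix T1 T2 assume "T1 \<union> T2 = T \<and> T1 \<inter> T2 = {} \<and> T1 \<noteq> {} \<and> T2 \<noteq> {}"
  then have T12: "T1 \<union> T2 = T" "T1 \<inter> T2 = {}"
    by auto
  then have T2: "T2 = T - T1"
    by auto
  let ?L = "heavy_partition G T" and ?U = "heavier_side G T T1"
  let ?m = "mincut (contract G ?L) (lift_verts (contract G ?L) T1) (lift_verts (contract G ?L) T2)"
  note L = partition_on_heavy_partition[OF T]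
  have "?m \<le> mincut G T1 T2"
  proof -
    obtain U where U: "T1 \<subseteq> U" "T2 \<inter> U = {}" "cut_weight G U \<le> mincut G T1 T2"
      using ex_cut_weight_le_mincut[OF wf T12(2)] by blast
    let ?W = "{P \<in> ?L. P \<subseteq> ?U}"
    have "?U \<subseteq> \<Union>?W"
    proof
      fix x assume x: "x \<in> ?U"
      show "x \<in> \<Union>?W"
      proof (cases "x \<in> T1")
        case True
        then have "{x} \<in> ?W"
          using T12 x by (auto simp: heavy_partition_def)
        then show ?thesis
          by blast
      next
        case False
        let ?P = "{v \<in> verts G - T. heavy_sets G T v = heavy_sets G T x}"
        have x': "x \<in> verts G - T" "T1 \<in> heavy_sets G T x"
          using x False T12 by (auto simp: heavier_side_def heavy_sets_def)
        then have "?P \<subseteq> ?U"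
          by (auto simp: heavier_side_def heavy_sets_def)
        then have "?P \<in> ?W"
          using x' by (auto simp: heavy_partition_def)
        then show ?thesis
          using x' by blast
      qed
    qed
    then have W: "\<Union>?W = ?U"
      by auto
    have "T1 \<subseteq> \<Union>?W" "T2 \<inter> \<Union>?W = {}"
      unfolding W using T12 by (auto simp: heavier_side_def)
    then have "?m \<le> cut_weight G (\<Union>?W)"
      by (intro mincut_contract_le[OF wf L]) auto
    also have "\<dots> \<le> cut_weight G U"
      unfolding W by (rule cut_weight_heavier_side_le[OF wf qb T12 U(1,2)])
    finally show ?thesis
      using U(3) by simp
  qed
  moreover have "mincut G T1 T2 \<le> ?m"
  proof -
    have "s = t" if "P \<in> ?L" "s \<in> P \<inter> (T1 \<union> T2)" "t \<in> P \<inter> (T1 \<union> T2)" for P s t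
      using that unfolding T12(1) by (auto simp: heavy_partition_def)
    then have "\<exists>W\<subseteq>?L. T1 \<subseteq> \<Union>W \<and> T2 \<inter> \<Union>W = {} \<and> cut_weight G (\<Union>W) \<le> ?m"
      using T T12 by (intro ex_cut_weight_le_mincut_contract[OF wf L _ T12(2)]) auto
    then obtain W where "T1 \<subseteq> \<Union>W" "T2 \<inter> \<Union>W = {}" "cut_weight G (\<Union>W) \<le> ?m"
      by blast
    then show ?thesis
      using mincut_le_cut_weight[OF wf, of T1 "\<Union>W" T2] by linarith
  qed
  ultimately show "?m = mincut G T1 T2"
    by simp
qed

lemma card_heavy_partition_le:
  assumes "wf_graph G" "finite T" "card T \<ge> 2"
  shows "card (heavy_partition G T) \<le> 2 ^ (4 * (card T)\<^sup>2)"
proof -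
  let ?k = "card T"
  have "finite (verts G - T)"
    using assms(1) by (simp add: wf_graph_def)
  then have "card (heavy_partition G T) \<le> ?k + card (heavy_sets G T ` (verts G - T))"
    unfolding heavy_partition_def using assms(2)
    by (intro order.trans[OF card_Un_le] add_mono card_image_le finite_imageI)
  also have "\<dots> \<le> 2 ^ ?k + (2 ^ ?k + 1) ^ (?k + 1)"
    using card_heavy_sets_le[OF assms(1,2)] less_exp[of ?k] by linarith
  \<comment> \<open>Both summands are at most \<open>(2 ^ (?k + 1)) ^ (?k + 1)\<close>, and doubling
    adds one to the exponent.\<close>
  also have "\<dots> \<le> (2 ^ (?k + 1)) ^ (?k + 1) + (2 ^ (?k + 1)) ^ (?k + 1)"
  proof (rule add_mono)
    have "(2::nat) ^ ?k + 1 \<le> 2 ^ (?k + 1)"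
      by simp
    then show "((2::nat) ^ ?k + 1) ^ (?k + 1) \<le> (2 ^ (?k + 1)) ^ (?k + 1)"
      by (rule power_mono) simp
    show "(2::nat) ^ ?k \<le> (2 ^ (?k + 1)) ^ (?k + 1)"
      unfolding power_mult[symmetric] by (rule power_increasing) auto
  qed
  also have "\<dots> = 2 ^ ((?k + 1) * (?k + 1) + 1)"
    by (simp only: power_mult power_add power_one_right mult_2_right)
  also have "\<dots> \<le> 2 ^ (4 * ?k\<^sup>2)"
  proof (rule power_increasing)
    \<comment> \<open>After this substitution the comparison holds coefficient by coefficient; it
      fails for \<open>?k = 1\<close>.\<close>
    obtain j where "?k = j + 2"
      using assms(3) by (metis add.commute le_Suc_ex)
    then show "(?k + 1) * (?k + 1) + 1 \<le> 4 * ?k\<^sup>2"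
      by (simp add: power2_eq_square algebra_simps)
  qed simp
  finally show ?thesis .
qed

lemma ex_exact_contraction:
  assumes wf: "wf_graph G" and T: "T \<subseteq> verts G" "card T = k" "k \<ge> 1"
    and qb: "quasi_bipartite G T"
  shows "\<exists>H. contraction_based_sparsifier G T H \<and> exact_cut_sparsifier G T H \<and>
    real (card (verts H)) \<le> 2 powr (4 * (real k)\<^sup>2 * log 2 (real k))"
proof (cases "k = 1")
  case True
  then obtain t where t: "T = {t}"
    using T(2) card_1_singletonE by blast
  \<comment> \<open>For one terminal the logarithm vanishes and the bound is a single vertex, so
    everything is merged; exactness is vacuous because \<open>{t}\<close> has no bipartition into
    non-empty sides.\<close>
  have "partition_on (verts G) {verts G}"
    using T(1) t by (intro partition_on_space) auto
  then have "contraction_based_sparsifier G T (contract G {verts G})"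
    unfolding contraction_based_sparsifier_def t by blast
  moreover have "exact_cut_sparsifier G T (contract G {verts G})"
    unfolding exact_cut_sparsifier_def t by (auto simp: Un_singleton_iff)
  ultimately show ?thesis
    using True by (intro exI[of _ "contract G {verts G}"]) (simp add: contract_def)
next
  case False
  then have k: "k \<ge> 2"
    using T(3) by simp
  have "finite T"
    using T(2,3) card.infinite by fastforce
  let ?H = "contract G (heavy_partition G T)"
  have "contraction_based_sparsifier G T ?H"
    unfolding contraction_based_sparsifier_def
    using partition_on_heavy_partition[OF T(1)]
    by (intro exI[of _ "heavy_partition G T"]) (auto simp: heavy_partition_def)
  moreover have "real (card (verts ?H)) \<le> 2 powr (4 * (real k)\<^sup>2 * log 2 (real k))"
  proof -
    have "real (card (verts ?H)) \<le> real (2 ^ (4 * k\<^sup>2))"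
      using card_heavy_partition_le[OF wf \<open>finite T\<close>] T(2) k
      by (simp only: of_nat_le_iff) (simp add: contract_def)
    also have "\<dots> = 2 powr (4 * (real k)\<^sup>2)"
      by (simp add: powr_realpow[symmetric])
    also have "\<dots> \<le> 2 powr (4 * (real k)\<^sup>2 * log 2 (real k))"
    proof (rule powr_mono)
      \<comment> \<open>From \<open>k = 2\<close> on the logarithm is at least one, so the stronger
        bound without it suffices.\<close>
      have "1 \<le> log 2 (real k)"
        using k by (simp add: le_log_iff)
      then show "4 * (real k)\<^sup>2 \<le> 4 * (real k)\<^sup>2 * log 2 (real k)"
        by (simp add: mult_le_cancel_left1)
    qed simp
    finally show ?thesis .
  qed
  ultimately show ?thesis
    using exact_cut_sparsifier_heavy_partition[OF wf T(1) qb] by blast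
qed

section \<open>The lower bound\<close>

text \<open>If \<open>u\<close> and \<open>v\<close> shared a part, every cut of the contraction
  would keep them together and so cost strictly more than \<open>heavier_side G T T1\<close>,
  whereas exactness forces its minimum cut down to \<open>mincut G T1 T2\<close>.\<close>

lemma exact_contraction_separates:
  assumes wf: "wf_graph G" and T: "T \<subseteq> verts G" and qb: "quasi_bipartite G T"
    and L: "partition_on (verts G) L" "\<forall>P\<in>L. \<forall>s\<in>P \<inter> T. \<forall>t\<in>P \<inter> T. s = t"
    and exact: "exact_cut_sparsifier G T (contract G L)"
    and T12: "T1 \<union> T2 = T" "T1 \<inter> T2 = {}" "T1 \<noteq> {}" "T2 \<noteq> {}"
    and uv: "u \<in> verts G - T" "v \<in> verts G - T"
    and opp: "link G u T1 > link G u T2" "link G v T1 < link G v T2"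
    and P: "P \<in> L" "u \<in> P"
  shows "v \<notin> P"
proof
  assume "v \<in> P"
  obtain W where W: "W \<subseteq> L" "T1 \<subseteq> \<Union>W" "T2 \<inter> \<Union>W = {}"
      "cut_weight G (\<Union>W) \<le>
        mincut (contract G L) (lift_verts (contract G L) T1) (lift_verts (contract G L) T2)"
  proof -
    have "T1 \<union> T2 \<subseteq> verts G"
      using T T12 by simp
    moreover have "s = t" if "Q \<in> L" "s \<in> Q \<inter> (T1 \<union> T2)" "t \<in> Q \<inter> (T1 \<union> T2)" for Q s t
      using L(2) that unfolding T12(1) by simp
    ultimately show ?thesis
      using ex_cut_weight_le_mincut_contract[OF wf L(1) _ T12(2)] that by meson
  qed
  have "u \<in> \<Union>W \<longleftrightarrow> v \<in> \<Union>W"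
    using partition_on_part_unique[OF L(1)] P \<open>v \<in> P\<close> W(1) by blast
  then have "cut_weight G (heavier_side G T T1) < cut_weight G (\<Union>W)"
    using cut_weight_heavier_side_less[OF wf qb T12(1,2) W(2,3) uv] opp by blast
  also have "\<dots> \<le> mincut G T1 T2"
    using W(4) exact T12 by (simp add: exact_cut_sparsifier_def)
  also have "\<dots> \<le> cut_weight G (heavier_side G T T1)"
    using T12 by (intro mincut_le_cut_weight[OF wf]) (auto simp: heavier_side_def)
  finally show False
    by simp
qed

text \<open>The negative product encodes strictly opposite preferences in either order. Distinct
  non-terminals then need distinct parts, so \<open>part\<close> is injective on them.\<close>

lemma card_exact_contraction_ge:
  assumes wf: "wf_graph G" and T: "T \<subseteq> verts G" and qb: "quasi_bipartite G T"
    and H: "contraction_based_sparsifier G T H" "exact_cut_sparsifier G T H"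
    and opp: "\<And>u v. \<lbrakk>u \<in> verts G - T; v \<in> verts G - T; u \<noteq> v\<rbrakk> \<Longrightarrow>
      \<exists>S\<subseteq>T. S \<noteq> {} \<and> T - S \<noteq> {} \<and>
        (link G u S - link G u (T - S)) * (link G v S - link G v (T - S)) < 0"
  shows "card (verts G - T) \<le> card (verts H)"
proof -
  obtain L where L: "partition_on (verts G) L" "\<forall>P\<in>L. \<forall>s\<in>P \<inter> T. \<forall>t\<in>P \<inter> T. s = t"
      "H = contract G L"
    using H(1) by (auto simp: contraction_based_sparsifier_def)
  have "\<forall>v\<in>verts G. \<exists>P\<in>L. v \<in> P"
    using partition_onD1[OF L(1)] by auto
  then obtain part where part: "\<And>v. v \<in> verts G \<Longrightarrow> part v \<in> L \<and> v \<in> part v"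
    by metis
  have "inj_on part (verts G - T)"
  proof (rule inj_onI, rule ccontr)
    fix u v assume uv: "u \<in> verts G - T" "v \<in> verts G - T" "part u = part v" "u \<noteq> v"
    then obtain S where S: "S \<subseteq> T" "S \<noteq> {}" "T - S \<noteq> {}"
        "(link G u S - link G u (T - S)) * (link G v S - link G v (T - S)) < 0"
      using opp[OF uv(1,2,4)] by blast
    have T12: "S \<union> (T - S) = T" "S \<inter> (T - S) = {}"
      using S by auto
    note sep = exact_contraction_separates[OF wf T qb L(1,2) H(2)[unfolded L(3)] T12 S(2,3)]
    have "v \<in> part u" "u \<in> part v" "part u \<in> L" "part v \<in> L" "u \<in> part u" "v \<in> part v"
      using part uv by auto
    \<comment> \<open>A negative product leaves two sign patterns, hence both orders of
      \<open>u\<close> and \<open>v\<close>.\<close>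
    then show False
      using sep[of u v "part u"] sep[of v u "part v"] S(4) uv
      by (auto simp: mult_less_0_iff)
  qed
  moreover have "part ` (verts G - T) \<subseteq> L"
    using part by auto
  moreover have "finite L"
    using finite_elements[OF _ L(1)] wf by (auto simp: wf_graph_def)
  ultimately show ?thesis
    unfolding L(3) by (simp add: contract_def card_inj_on_le)
qed

section \<open>Majorities of odd sets\<close>

text \<open>Splitting \<open>A \<inter> B\<close> as evenly as possible leaves \<open>A - B\<close> and \<open>B - A\<close> to decide the majorities.\<close>

lemma odd_sets_opposite_majorities_aux:
  assumes fin: "finite A" "finite B" and "odd (card A)" "odd (card B)" and "B - A \<noteq> {}"
  shows "\<exists>S\<subseteq>A. card (A - S) < card (A \<inter> S) \<and> card (B \<inter> S) < card (B - S)"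
proof -
  define j where "j = card (A \<inter> B)"
  have "(j + 1) div 2 \<le> card (A \<inter> B)"
    unfolding j_def by simp
  \<comment> \<open>Half of the intersection, rounded up: an odd \<open>j\<close> gives
    \<open>I\<close> one element more than it leaves out.\<close>
  then obtain I where I: "I \<subseteq> A \<inter> B" "card I = (j + 1) div 2" "finite I"
    by (rule obtain_subset_with_card_n)
  have cA: "card A = j + card (A - B)" and cB: "card B = j + card (B - A)"
    using fin card_Int_Diff[of A B] card_Int_Diff[of B A] by (simp_all add: j_def Int_commute)
  have pos: "card (B - A) > 0"
    using assms by (simp add: card_gt_0_iff)
  let ?S = "I \<union> (A - B)"
  have "A \<inter> ?S = I \<union> (A - B)" "B \<inter> ?S = I" and "I \<inter> (A - B) = {}"
    using I(1) by blast+
  then have "card (A \<inter> ?S) = (j + 1) div 2 + card (A - B)" "card (B \<inter> ?S) = (j + 1) div 2"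
    using I(2,3) fin by (simp_all add: card_Un_disjoint)
  moreover have "card A = card (A \<inter> ?S) + card (A - ?S)" "card B = card (B \<inter> ?S) + card (B - ?S)"
    using fin card_Int_Diff by blast+
  \<comment> \<open>For even \<open>j\<close> the common part is balanced, \<open>A - B\<close> has
    odd size and \<open>B - A\<close> is non-empty. For odd \<open>j\<close> the common part favours
    \<open>?S\<close> by one, and \<open>B - A\<close>, of positive even size, outweighs
    that.\<close>
  ultimately have "card (A - ?S) < card (A \<inter> ?S) \<and> card (B \<inter> ?S) < card (B - ?S)"
    using cA cB pos assms(3,4) by presburger
  moreover have "?S \<subseteq> A"
    using I by auto
  ultimately show ?thesis
    by blast
qed

text \<open>The product is symmetric in \<open>A\<close> and \<open>B\<close>, so whichever
  difference is non-empty can play the role of \<open>B - A\<close>.\<close>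

lemma odd_sets_opposite_majorities:
  assumes fin: "finite A" "finite B" and odd: "odd (card A)" "odd (card B)" and "A \<noteq> B"
  shows "\<exists>S\<subseteq>A \<union> B. (real (card (A \<inter> S)) - real (card (A - S))) *
    (real (card (B \<inter> S)) - real (card (B - S))) < 0"
proof (cases "B - A = {}")
  case True
  then have "A - B \<noteq> {}"
    using assms(5) by auto
  then obtain S where "S \<subseteq> B" "card (B - S) < card (B \<inter> S)" "card (A \<inter> S) < card (A - S)"
    using odd_sets_opposite_majorities_aux[OF fin(2,1) odd(2,1)] by blast
  then show ?thesis
    by (intro exI[of _ S]) (auto simp: mult_less_0_iff)
next
  case False
  then obtain S where "S \<subseteq> A" "card (A - S) < card (A \<inter> S)" "card (B \<inter> S) < card (B - S)"
    using odd_sets_opposite_majorities_aux[OF fin odd] by blast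
  then show ?thesis
    by (intro exI[of _ S]) (auto simp: mult_less_0_iff)
qed

text \<open>For a fixed \<open>a\<close>, every subset of \<open>A - {a}\<close> extends to exactly
  one odd subset of \<open>A\<close> by adding \<open>a\<close> or not.\<close>

lemma card_odd_subsets:
  assumes "finite A" "A \<noteq> {}"
  shows "card {S. S \<subseteq> A \<and> odd (card S)} = 2 ^ (card A - 1)"
proof -
  obtain a where a: "a \<in> A"
    using assms by blast
  let ?toggle = "\<lambda>S. if odd (card S) then S else insert a S"
  have "bij_betw ?toggle (Pow (A - {a})) {S. S \<subseteq> A \<and> odd (card S)}"
  proof (rule bij_betw_byWitness[where f' = "\<lambda>S. S - {a}"])
    have fin: "finite S" if "S \<subseteq> A" for S
      using that assms finite_subset by blast
    show "\<forall>S\<in>Pow (A - {a}). ?toggle S - {a} = S"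
      by auto
    show "\<forall>S\<in>{S. S \<subseteq> A \<and> odd (card S)}. ?toggle (S - {a}) = S"
      using fin by (auto simp: insert_absorb card_Diff_singleton_if split: if_splits)
    show "?toggle ` Pow (A - {a}) \<subseteq> {S. S \<subseteq> A \<and> odd (card S)}"
    proof
      fix X assume "X \<in> ?toggle ` Pow (A - {a})"
      then obtain S where S: "S \<subseteq> A - {a}" "X = ?toggle S"
        by auto
      then have "a \<notin> S" "finite S"
        using fin[of S] by auto
      then show "X \<in> {S. S \<subseteq> A \<and> odd (card S)}"
        using S a by auto
    qed
    show "(\<lambda>S. S - {a}) ` {S. S \<subseteq> A \<and> odd (card S)} \<subseteq> Pow (A - {a})"
      by auto
  qed
  then have "card {S. S \<subseteq> A \<and> odd (card S)} = card (Pow (A - {a}))"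
    by (simp add: bij_betw_same_card)
  then show ?thesis
    using assms a by (simp add: card_Pow)
qed

section \<open>The graph of all odd sets\<close>

text \<open>
  The terminals are \<open>0, \<dots>, k - 1\<close>; the set \<open>S\<close> of terminals is encoded by the non-terminal
  \<open>k + set_encode S\<close>.
\<close>

definition odd_codes :: "nat \<Rightarrow> nat set" where
  "odd_codes k = set_encode ` {S. S \<subseteq> {..<k} \<and> odd (card S)}"

definition odd_graph :: "nat \<Rightarrow> (nat, nat) wgraph" where
  "odd_graph k = \<lparr>
     verts = {..<k} \<union> (+) k ` odd_codes k,
     edges = prod_encode ` (SIGMA s:odd_codes k. set_decode s),
     ends = (\<lambda>e. case prod_decode e of (s, t) \<Rightarrow> {k + s, t}),
     weight = (\<lambda>_. 1)\<rparr>"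

lemma odd_codes_decode:
  assumes "s \<in> odd_codes k"
  shows "set_decode s \<subseteq> {..<k}" "odd (card (set_decode s))"
  using assms finite_subset[of _ "{..<k}"] by (auto simp: odd_codes_def)

lemma card_odd_codes:
  assumes "k \<ge> 1"
  shows "card (odd_codes k) = 2 ^ (k - 1)"
proof -
  have "inj_on set_encode {S. S \<subseteq> {..<k} \<and> odd (card S)}"
    by (rule inj_on_subset[OF inj_on_set_encode]) (auto intro: finite_subset)
  then show ?thesis
    using card_odd_subsets[of "{..<k}"] assms by (simp add: odd_codes_def card_image lessThan_empty_iff)
qed

lemma finite_odd_codes: "finite (odd_codes k)"
proof -
  have "finite {S. S \<subseteq> {..<k} \<and> odd (card S)}"
    by (rule finite_subset[of _ "Pow {..<k}"]) auto
  then show ?thesis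
    by (simp add: odd_codes_def)
qed

lemma odd_graph_edgeE:
  assumes "e \<in> edges (odd_graph k)"
  obtains s t where "e = prod_encode (s, t)" "s \<in> odd_codes k" "t \<in> set_decode s" "t < k"
    "ends (odd_graph k) e = {k + s, t}"
proof -
  obtain s t where st: "e = prod_encode (s, t)" "s \<in> odd_codes k" "t \<in> set_decode s"
    using assms by (auto simp: odd_graph_def)
  moreover have "t < k"
    using st odd_codes_decode(1) by blast
  moreover have "ends (odd_graph k) e = {k + s, t}"
    using st by (simp add: odd_graph_def)
  ultimately show thesis
    by (rule that)
qed

lemma wf_odd_graph: "wf_graph (odd_graph k)"
proof -
  have "ends (odd_graph k) e \<subseteq> verts (odd_graph k) \<and> card (ends (odd_graph k) e) = 2"
    if e: "e \<in> edges (odd_graph k)" for e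
  proof -
    obtain s t where "s \<in> odd_codes k" "t < k" "ends (odd_graph k) e = {k + s, t}"
      by (rule odd_graph_edgeE[OF e])
    then show ?thesis
      by (auto simp: odd_graph_def)
  qed
  then show ?thesis
    using finite_odd_codes by (auto simp: wf_graph_def odd_graph_def finite_set_decode)
qed

text \<open>The terminal is the end below \<open>k\<close>, so the unordered ends determine both
  \<open>s\<close> and \<open>t\<close>.\<close>

lemma simple_odd_graph: "simple_graph (odd_graph k)"
  unfolding simple_graph_def
proof (rule inj_onI)
  fix e e' assume e: "e \<in> edges (odd_graph k)" "e' \<in> edges (odd_graph k)"
    and eq: "ends (odd_graph k) e = ends (odd_graph k) e'"
  obtain s t where "e = prod_encode (s, t)" "t < k" "ends (odd_graph k) e = {k + s, t}"
    by (rule odd_graph_edgeE[OF e(1)])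
  moreover obtain s' t' where "e' = prod_encode (s', t')" "t' < k"
      "ends (odd_graph k) e' = {k + s', t'}"
    by (rule odd_graph_edgeE[OF e(2)])
  ultimately show "e = e'"
    using eq by (auto simp: doubleton_eq_iff)
qed

lemma quasi_bipartite_odd_graph: "quasi_bipartite (odd_graph k) {..<k}"
  unfolding quasi_bipartite_def
proof
  fix e assume "e \<in> edges (odd_graph k)"
  then show "ends (odd_graph k) e \<inter> {..<k} \<noteq> {}"
    by (rule odd_graph_edgeE) auto
qed

lemma nonterminals_odd_graph: "verts (odd_graph k) - {..<k} = (+) k ` odd_codes k"
proof -
  have "(+) k ` odd_codes k \<inter> {..<k} = {}"
    by auto
  then show ?thesis
    by (simp add: odd_graph_def Un_Diff Diff_triv)
qed

text \<open>Unit weights make the link a count, which turns heavier sides into majorities.\<close>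

lemma link_odd_graph:
  assumes "s \<in> odd_codes k" "S \<subseteq> {..<k}"
  shows "link (odd_graph k) (k + s) S = real (card (set_decode s \<inter> S))"
proof -
  have "{e \<in> edges (odd_graph k). k + s \<in> ends (odd_graph k) e \<and> ends (odd_graph k) e \<inter> S \<noteq> {}}
      = (\<lambda>t. prod_encode (s, t)) ` (set_decode s \<inter> S)" (is "?E = ?R")
  proof (intro set_eqI iffI)
    fix e assume e: "e \<in> ?E"
    then have "e \<in> edges (odd_graph k)"
      by simp
    then obtain s' t where "e = prod_encode (s', t)" "t \<in> set_decode s'" "t < k"
        "ends (odd_graph k) e = {k + s', t}"
      by (rule odd_graph_edgeE)
    then show "e \<in> ?R"
      using e assms(2) by auto
  next
    fix e assume "e \<in> ?R"
    then show "e \<in> ?E"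
      using assms by (auto simp: odd_graph_def)
  qed
  moreover have "inj_on (\<lambda>t. prod_encode (s, t)) (set_decode s \<inter> S)"
    by (auto intro: inj_onI)
  ultimately show ?thesis
    by (simp add: link_def odd_graph_def card_image)
qed

lemma odd_graph_opposite_links:
  assumes uv: "u \<in> verts (odd_graph k) - {..<k}" "v \<in> verts (odd_graph k) - {..<k}" "u \<noteq> v"
  shows "\<exists>S\<subseteq>{..<k}. S \<noteq> {} \<and> {..<k} - S \<noteq> {} \<and>
    (link (odd_graph k) u S - link (odd_graph k) u ({..<k} - S)) *
    (link (odd_graph k) v S - link (odd_graph k) v ({..<k} - S)) < 0"
proof -
  obtain a b where ab: "u = k + a" "v = k + b" "a \<in> odd_codes k" "b \<in> odd_codes k"
    using uv unfolding nonterminals_odd_graph by auto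
  let ?A = "set_decode a" and ?B = "set_decode b"
  have sub: "?A \<subseteq> {..<k}" "?B \<subseteq> {..<k}"
    using ab odd_codes_decode by auto
  have "?A \<noteq> ?B"
    using ab uv(3) by (metis set_decode_inverse)
  then obtain S where S: "S \<subseteq> ?A \<union> ?B" "(real (card (?A \<inter> S)) - real (card (?A - S))) *
      (real (card (?B \<inter> S)) - real (card (?B - S))) < 0"
    using odd_sets_opposite_majorities[of ?A ?B] odd_codes_decode(2) ab finite_set_decode by blast
  have Sk: "S \<subseteq> {..<k}"
    using S(1) sub by auto
  have "?A \<inter> ({..<k} - S) = ?A - S" "?B \<inter> ({..<k} - S) = ?B - S"
    using sub by auto
  then have links: "link (odd_graph k) u S = real (card (?A \<inter> S))"
      "link (odd_graph k) u ({..<k} - S) = real (card (?A - S))"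
      "link (odd_graph k) v S = real (card (?B \<inter> S))"
      "link (odd_graph k) v ({..<k} - S) = real (card (?B - S))"
    using ab Sk by (simp_all add: link_odd_graph)
  \<comment> \<open>With an empty side both differences would have the same weak sign, and their
    product could not be negative.\<close>
  have "S \<noteq> {}"
    using S(2) by (auto simp: mult_less_0_iff)
  moreover have "{..<k} - S \<noteq> {}"
  proof
    assume "{..<k} - S = {}"
    then have "?A - S = {}" "?B - S = {}"
      using sub by auto
    then have "card (?A - S) = 0" "card (?B - S) = 0"
      by (simp_all only: card.empty)
    then show False
      using S(2) by (simp only: mult_less_0_iff) linarith
  qed
  ultimately show ?thesis
    using Sk S(2) by (intro exI[of _ S] conjI; (simp only: links)?)
qed

text \<open>The \<open>2 ^ (k - 1)\<close> non-terminals need pairwise different parts.\<close>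

lemma card_exact_contraction_odd_graph_ge:
  assumes "k \<ge> 1" "contraction_based_sparsifier (odd_graph k) {..<k} H"
    "exact_cut_sparsifier (odd_graph k) {..<k} H"
  shows "real (card (verts H)) \<ge> 1 / 2 * 2 ^ k"
proof -
  have "{..<k} \<subseteq> verts (odd_graph k)"
    by (auto simp: odd_graph_def)
  then have "card (verts (odd_graph k) - {..<k}) \<le> card (verts H)"
    by (rule card_exact_contraction_ge[OF wf_odd_graph _ quasi_bipartite_odd_graph assms(2,3)
          odd_graph_opposite_links])
  then have "2 ^ (k - 1) \<le> card (verts H)"
    unfolding nonterminals_odd_graph by (simp add: card_image card_odd_codes[OF assms(1)])
  then have "real (2 ^ (k - 1)) \<le> real (card (verts H))"
    by (simp only: of_nat_le_iff)
  then show ?thesis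
    using assms(1) by (cases k) auto
qed

theorem theorem1p2:
  shows
    "(\<exists>C::real. C > 0 \<and>
       (\<forall>k::nat. k \<ge> 1 \<longrightarrow>
         (\<forall>(G :: ('v, 'e) wgraph) T.
            wf_graph G \<and> T \<subseteq> verts G \<and> card T = k \<and> quasi_bipartite G T \<longrightarrow>
            (\<exists>H. contraction_based_sparsifier G T H \<and> exact_cut_sparsifier G T H \<and>
                 real (card (verts H)) \<le> 2 powr (C * (real k)\<^sup>2 * log 2 (real k))))))
     \<and>
     (\<exists>c::real. c > 0 \<and>
       (\<forall>k::nat. k \<ge> 1 \<longrightarrow>
         (\<exists>(G :: (nat, nat) wgraph) T.
            wf_graph G \<and> simple_graph G \<and> T \<subseteq> verts G \<and> card T = k \<and> quasi_bipartite G T \<and>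
            (\<forall>H. contraction_based_sparsifier G T H \<and> exact_cut_sparsifier G T H \<longrightarrow>
                 real (card (verts H)) \<ge> c * 2 ^ k))))"
proof (rule conjI)
  show "\<exists>C::real. C > 0 \<and>
       (\<forall>k::nat. k \<ge> 1 \<longrightarrow>
         (\<forall>(G :: ('v, 'e) wgraph) T.
            wf_graph G \<and> T \<subseteq> verts G \<and> card T = k \<and> quasi_bipartite G T \<longrightarrow>
            (\<exists>H. contraction_based_sparsifier G T H \<and> exact_cut_sparsifier G T H \<and>
                 real (card (verts H)) \<le> 2 powr (C * (real k)\<^sup>2 * log 2 (real k)))))"
    \<comment> \<open>The constant comes from
      \<open>(k + 1) * (k + 1) + 1 \<le> 4 * k\<^sup>2\<close> for \<open>k \<ge> 2\<close>.\<close>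
    by (rule exI[of _ 4]) (use ex_exact_contraction in auto)
next
  show "\<exists>c::real. c > 0 \<and>
       (\<forall>k::nat. k \<ge> 1 \<longrightarrow>
         (\<exists>(G :: (nat, nat) wgraph) T.
            wf_graph G \<and> simple_graph G \<and> T \<subseteq> verts G \<and> card T = k \<and> quasi_bipartite G T \<and>
            (\<forall>H. contraction_based_sparsifier G T H \<and> exact_cut_sparsifier G T H \<longrightarrow>
                 real (card (verts H)) \<ge> c * 2 ^ k)))"
  \<comment> \<open>One half, because odd sets make up half of the \<open>2 ^ k\<close> sets of
    terminals.\<close>
  proof (intro exI[of _ "1 / 2"] conjI allI impI)
    fix k :: nat assume "k \<ge> 1"
    then have "\<forall>H. contraction_based_sparsifier (odd_graph k) {..<k} H \<and>
        exact_cut_sparsifier (odd_graph k) {..<k} H \<longrightarrow> real (card (verts H)) \<ge> 1 / 2 * 2 ^ k"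
      using card_exact_contraction_odd_graph_ge by blast
    moreover have "{..<k} \<subseteq> verts (odd_graph k)"
      by (auto simp: odd_graph_def)
    ultimately show "\<exists>(G :: (nat, nat) wgraph) T.
        wf_graph G \<and> simple_graph G \<and> T \<subseteq> verts G \<and> card T = k \<and> quasi_bipartite G T \<and>
        (\<forall>H. contraction_based_sparsifier G T H \<and> exact_cut_sparsifier G T H \<longrightarrow>
          real (card (verts H)) \<ge> 1 / 2 * 2 ^ k)"
      using wf_odd_graph simple_odd_graph quasi_bipartite_odd_graph
      by (intro exI[of _ "odd_graph k"] exI[of _ "{..<k}"]) auto
  qed simp
qed

end
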